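(* Each of the following Diophantine equations has exactly five solutions $(x,n)$ in non-negative integers, the values of $n$ occurring in these solutions being as indicated: \begin{enumerate} \item $x^2=28\cdot 3^{n}+2997$: $n=0,2,5,6,10$; \item $x^2=70\cdot 3^{n}+414$: $n=0,3,4,5,8$; \item $x^2=130\cdot 3^{n}+5550606$: $n=0,6,11,15,16$; \item $x^2=148\cdot 3^{n}+41877$: $n=0,5,6,9,17$; \item $x^2=8740\cdot 3^{n}+57402189$: $n=0,4,9,15,29$; \item $x^2=6\cdot 5^{n}+11875$: $n=0,4,5,6,9$; \item $x^2=14\cdot 5^{n}+6875$: $n=0,2,4,5,6$; \item $x^2=248\cdot 6^{n}+23161$: $n=0,1,3,4,5$; \item $x^2=1513\cdot 6^{n}+19379701008$: $n=0,7,9,10,12$. \end{enumerate} *)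

theory Defs
  imports Main
begin

definition solutions :: "nat \<Rightarrow> nat \<Rightarrow> nat \<Rightarrow> (nat \<times> nat) set" where
  "solutions a b c = {(x, n). x ^ 2 = a * b ^ n + c}"

end

theory Submission
  imports Defs
begin

text \<open>Put \<open>n = 2 m + r\<close> with \<open>r \<in> {0, 1}\<close>. For \<open>m\<close> large, a square \<open>f\<^sup>2\<close> divides the whole equation, and
  dividing by it leaves \<open>x\<^sup>2 = D y\<^sup>2 + N\<close> with \<open>y = g p\<^sup>i\<close>, where \<open>g\<close> can be chosen so that only
  exponents beyond the largest known one remain. By Pell descent, \<open>x + y \<surd>D\<close> is one of finitely many
  fundamental solutions times a power \<open>\<epsilon>\<^sup>k\<close> of a unit. The divisibility \<open>g | y\<close> confines \<open>k\<close> to few residue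
  classes modulo the order of \<open>\<epsilon>\<close> modulo \<open>g\<close>. In each of these classes there are primes \<open>q\<close> for which
  \<open>\<epsilon>\<close> has small order relative to that modulus, so that \<open>y\<close> modulo \<open>q\<close> is known, and for which it
  lies outside the coset \<open>g \<langle>p\<rangle>\<close>.\<close>

subsection \<open>Arithmetic in the order generated by a square root\<close>

text \<open>The pair \<open>(a, b)\<close> stands for \<open>a + b \<surd>D\<close>.\<close>

fun qmul :: "int \<Rightarrow> int \<times> int \<Rightarrow> int \<times> int \<Rightarrow> int \<times> int" where
  "qmul D (a, b) (c, d) = (a * c + D * b * d, a * d + b * c)"

primrec qpow :: "int \<Rightarrow> int \<times> int \<Rightarrow> nat \<Rightarrow> int \<times> int" where
  "qpow D z 0 = (1, 0)"
| "qpow D z (Suc k) = qmul D z (qpow D z k)"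

fun qmod :: "int \<Rightarrow> int \<times> int \<Rightarrow> int \<times> int" where
  "qmod Q (a, b) = (a mod Q, b mod Q)"

lemma qmul_assoc: "qmul D (qmul D x y) z = qmul D x (qmul D y z)"
  by (cases x; cases y; cases z) (simp add: algebra_simps)

lemma qmul_commute: "qmul D x y = qmul D y x"
  by (cases x; cases y) (simp add: algebra_simps)

lemma qmul_one [simp]: "qmul D z (1, 0) = z" "qmul D (1, 0) z = z"
  by (cases z; simp)+

lemma qpow_add: "qpow D z (m + n) = qmul D (qpow D z m) (qpow D z n)"
  by (induction m) (simp_all add: qmul_assoc)

lemma qpow_mult: "qpow D z (m * n) = qpow D (qpow D z m) n"
  by (induction n) (simp_all add: qpow_add)

lemma qmod_qmod [simp]: "qmod Q (qmod Q z) = qmod Q z"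
  by (cases z) simp

lemma qmod_qmul_right: "qmod Q (qmul D x (qmod Q y)) = qmod Q (qmul D x y)"
  by (cases x; cases y) (auto intro!: mod_add_cong mod_mult_right_eq)

lemma qmod_qmul_cong:
  assumes "qmod Q x = qmod Q x'" "qmod Q y = qmod Q y'"
  shows "qmod Q (qmul D x y) = qmod Q (qmul D x' y')"
  using assms by (metis qmod_qmul_right qmul_commute)

lemma qmod_qpow_cong:
  assumes "qmod Q x = qmod Q y"
  shows "qmod Q (qpow D x k) = qmod Q (qpow D y k)"
  by (induction k) (auto intro!: qmod_qmul_cong assms)

lemma qpow_one [simp]: "qpow D (1, 0) k = (1, 0)"
  by (induction k) simp_all

lemma qmod_dvd:
  assumes "m dvd Q" "qmod Q x = qmod Q y"
  shows "qmod m x = qmod m y"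
  using assms by (cases x; cases y) (auto, (metis mod_mod_cancel)+)

subsection \<open>Descent to fundamental solutions\<close>

text \<open>\<open>(x', y')\<close> is \<open>(x, y)\<close> divided by the unit, and
  \<open>\<bar>y'\<bar> < y\<close> means that \<open>v * x\<close> lies strictly between
  \<open>(u - 1) * y\<close> and \<open>(u + 1) * y\<close>.\<close>

lemma pell_descent_step:
  fixes D N u v x y :: int
  assumes pell: "u\<^sup>2 = D * v\<^sup>2 + 1" and pos: "0 < u" "0 < v" "0 < D" "0 < N"
    and eq: "x\<^sup>2 = D * y\<^sup>2 + N" and xy: "0 < x" "0 \<le> y"
    and large: "v\<^sup>2 * N < 2 * (u + 1) * y\<^sup>2"
  defines "x' \<equiv> u * x - D * v * y" and "y' \<equiv> u * y - v * x"
  shows "x'\<^sup>2 = D * y'\<^sup>2 + N" "0 < x'" "\<bar>y'\<bar> < y" "(x, y) = qmul D (x', y') (u, v)"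
proof -
  have "x'\<^sup>2 - D * y'\<^sup>2 = (u\<^sup>2 - D * v\<^sup>2) * (x\<^sup>2 - D * y\<^sup>2)"
    by (simp add: x'_def y'_def power2_eq_square algebra_simps)
  then show "x'\<^sup>2 = D * y'\<^sup>2 + N"
    using pell eq by simp
  have vx: "(v * x)\<^sup>2 = (u\<^sup>2 - 1) * y\<^sup>2 + v\<^sup>2 * N"
    using pell eq by (simp add: power_mult_distrib algebra_simps)
  have "y \<noteq> 0"
    using large pos by (auto simp: mult_less_0_iff)
  then have y: "0 < y"
    using xy by simp
  have "(v * x)\<^sup>2 < ((u + 1) * y)\<^sup>2"
    using vx large by (simp add: power2_eq_square algebra_simps)
  then have 1: "v * x < (u + 1) * y"
    using pos y by (intro power2_less_imp_less[of "v * x"]) auto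
  have "(u - 1) * y\<^sup>2 \<ge> 0" and "0 < v\<^sup>2 * N"
    using pos by auto
  then have "((u - 1) * y)\<^sup>2 < (v * x)\<^sup>2"
    using vx by (simp add: power2_eq_square algebra_simps)
  then have 2: "(u - 1) * y < v * x"
    using pos xy by (intro power2_less_imp_less[of "(u - 1) * y"]) auto
  show "\<bar>y'\<bar> < y"
    using 1 2 by (simp add: y'_def algebra_simps abs_less_iff)
  have "(u * x)\<^sup>2 = (D * v * y)\<^sup>2 + D * v\<^sup>2 * N + x\<^sup>2"
  proof -
    have "(u * x)\<^sup>2 = D * v\<^sup>2 * x\<^sup>2 + x\<^sup>2"
      using pell by (simp add: power_mult_distrib algebra_simps)
    then show ?thesis
      unfolding eq by (simp add: power2_eq_square algebra_simps)
  qed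
  moreover have "0 < D * v\<^sup>2 * N + x\<^sup>2"
    using pos by (simp add: add_pos_nonneg)
  ultimately have "(D * v * y)\<^sup>2 < (u * x)\<^sup>2"
    by linarith
  then have "D * v * y < u * x"
    using pos xy by (intro power2_less_imp_less[of "D * v * y"]) auto
  then show "0 < x'"
    by (simp add: x'_def)
  have "u * x' + D * y' * v = (u\<^sup>2 - D * v\<^sup>2) * x" "u * y' + v * x' = (u\<^sup>2 - D * v\<^sup>2) * y"
    by (simp_all add: x'_def y'_def power2_eq_square algebra_simps)
  then show "(x, y) = qmul D (x', y') (u, v)"
    using pell by (simp add: algebra_simps)
qed

text \<open>The bound on \<open>y\<close> is the exact threshold below which dividing by the unit \<open>u + v \<surd>D\<close>
  no longer decreases \<open>\<bar>y\<bar>\<close>.\<close>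

definition fundamental :: "int \<Rightarrow> int \<Rightarrow> int \<Rightarrow> int \<Rightarrow> (int \<times> int) list \<Rightarrow> bool" where
  "fundamental D N u v L \<longleftrightarrow>
     (\<forall>x y. 0 < x \<longrightarrow> 0 \<le> y \<longrightarrow> x\<^sup>2 = D * y\<^sup>2 + N \<longrightarrow> 2 * (u + 1) * y\<^sup>2 \<le> v\<^sup>2 * N \<longrightarrow> (x, y) \<in> set L)"

text \<open>Division by the unit lowers \<open>y\<close> until the threshold is reached or
  \<open>y'\<close> turns negative. In the latter case the conjugate \<open>(x', - y')\<close> is
  fundamental, whence the two signs.\<close>

lemma pell_descent:
  fixes D N u v x y :: int
  assumes pell: "u\<^sup>2 = D * v\<^sup>2 + 1" and pos: "0 < u" "0 < v" "0 < D" "0 < N"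
    and fund: "fundamental D N u v L"
  shows "x\<^sup>2 = D * y\<^sup>2 + N \<Longrightarrow> 0 < x \<Longrightarrow> 0 \<le> y \<Longrightarrow>
    \<exists>a b k. ((a, b) \<in> set L \<or> (a, - b) \<in> set L) \<and> (x, y) = qmul D (a, b) (qpow D (u, v) k)"
proof (induction "nat y" arbitrary: x y rule: less_induct)
  case less
  note eq = less.prems(1) and x = less.prems(2) and y = less.prems(3)
  show ?case
  proof (cases "v\<^sup>2 * N < 2 * (u + 1) * y\<^sup>2")
    case False
    then have "(x, y) \<in> set L"
      using fund eq x y unfolding fundamental_def by auto
    moreover have "(x, y) = qmul D (x, y) (qpow D (u, v) 0)"
      by simp
    ultimately show ?thesis
      by blast
  next
    case True
    define x' y' where "x' = u * x - D * v * y" and "y' = u * y - v * x"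
    note step = pell_descent_step[OF pell pos eq x y True, folded x'_def y'_def]
    show ?thesis
    proof (cases "0 \<le> y'")
      case True
      then have "nat y' < nat y"
        using step(3) by simp
      from less.hyps[OF this step(1,2) True] obtain a b k where
        ab: "(a, b) \<in> set L \<or> (a, - b) \<in> set L" and "(x', y') = qmul D (a, b) (qpow D (u, v) k)"
        by blast
      then have "(x, y) = qmul D (a, b) (qpow D (u, v) (Suc k))"
        using step(4) by (metis qmul_assoc qmul_commute qpow.simps(2))
      with ab show ?thesis
        by blast
    next
      case False
      \<comment> \<open>Dividing \<open>(x', - y')\<close> by the unit gives second coordinate
        \<open>- y\<close>; above the threshold this would yield
        \<open>y < - y' < y\<close>.\<close>
      have "\<not> v\<^sup>2 * N < 2 * (u + 1) * (- y')\<^sup>2"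
      proof
        assume large: "v\<^sup>2 * N < 2 * (u + 1) * (- y')\<^sup>2"
        have "x'\<^sup>2 = D * (- y')\<^sup>2 + N"
          using step(1) by simp
        from pell_descent_step(3)[OF pell pos this step(2) _ large] False
        have "\<bar>u * (- y') - v * x'\<bar> < - y'"
          by simp
        moreover have "u * (- y') - v * x' = - y"
          using step(4) by (simp add: algebra_simps)
        ultimately show False
          using step(3) y by simp
      qed
      then have "(x', - y') \<in> set L"
        using fund step(1,2) False unfolding fundamental_def by auto
      moreover have "(x, y) = qmul D (x', y') (qpow D (u, v) (Suc 0))"
        using step(4) by simp
      ultimately show ?thesis
        by blast
    qed
  qed
qed

subsection \<open>Sieving the exponent of the unit\<close>

fun pow_mod :: "int \<Rightarrow> num \<Rightarrow> int \<Rightarrow> int" where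
  "pow_mod x num.One m = x mod m"
| "pow_mod x (num.Bit0 n) m = (let y = pow_mod x n m in y * y mod m)"
| "pow_mod x (num.Bit1 n) m = (let y = pow_mod x n m in (y * y mod m) * x mod m)"

lemma pow_mod: "pow_mod x n m = x ^ numeral n mod m"
proof (induction x n m rule: pow_mod.induct)
  case (3 x n m)
  have "x ^ numeral (num.Bit1 n) = x ^ numeral n * x ^ numeral n * x"
    by (simp only: power_numeral_odd Let_def mult_ac)
  with 3 show ?case
    by (simp only: pow_mod.simps Let_def) (metis mod_mult_eq mod_mult_left_eq)
qed (simp_all add: Let_def mod_simps numeral_Bit0 power_add)

text \<open>Exponents are passed as integers and converted to binary, because \<open>code_simp\<close> expands literals of
  type \<^typ>\<open>nat\<close> into unary notation.\<close>

definition num_of :: "int \<Rightarrow> num" where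
  "num_of k = num_of_nat (nat k)"

lemma num_of_code [code]:
  "num_of 0 = num.One" "num_of (Int.Pos n) = n" "num_of (Int.Neg n) = num.One"
  by (simp_all add: num_of_def num_of_nat_numeral_eq)

primrec orbit :: "int \<Rightarrow> int \<Rightarrow> int \<times> int \<Rightarrow> nat \<Rightarrow> int \<times> int \<Rightarrow> (int \<times> int) list" where
  "orbit D Q e 0 z = []"
| "orbit D Q e (Suc r) z = z # orbit D Q e r (qmod Q (qmul D e z))"

primrec qpow_mod :: "int \<Rightarrow> int \<Rightarrow> int \<times> int \<Rightarrow> nat \<Rightarrow> int \<times> int" where
  "qpow_mod D Q z 0 = (1, 0)"
| "qpow_mod D Q z (Suc k) = qmod Q (qmul D z (qpow_mod D Q z k))"

lemma qpow_mod: "qmod Q (qpow_mod D Q z k) = qmod Q (qpow D z k)"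
  by (induction k) (simp_all, metis qmod_qmul_right)

lemma orbit_mem:
  assumes "j < r"
  shows "\<exists>z' \<in> set (orbit D Q e r z). qmod Q z' = qmod Q (qmul D z (qpow D e j))"
  using assms
proof (induction r arbitrary: j z)
  case (Suc r)
  show ?case
  proof (cases j)
    case (Suc i)
    then obtain z' where "z' \<in> set (orbit D Q e r (qmod Q (qmul D e z)))"
      "qmod Q z' = qmod Q (qmul D (qmod Q (qmul D e z)) (qpow D e i))"
      using Suc.IH[of i "qmod Q (qmul D e z)"] Suc.prems Suc by force
    moreover have "qmod Q (qmul D (qmod Q (qmul D e z)) (qpow D e i)) = qmod Q (qmul D z (qpow D e j))"
      using Suc by (metis qmod_qmul_right qmul_assoc qmul_commute qpow.simps(2))
    ultimately show ?thesis
      by auto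
  qed simp
qed simp

text \<open>A constant of its own: under a binder \<open>code_simp\<close> would unfold \<^const>\<open>pow_mod\<close> symbolically.\<close>

definition passes :: "num \<Rightarrow> int \<Rightarrow> int \<Rightarrow> int \<times> int \<Rightarrow> bool" where
  "passes n m G z \<longleftrightarrow> pow_mod (snd z) n m = G"

text \<open>The sieve looks for \<open>z \<in> S\<close> and \<open>k\<close> such that \<open>z e\<^sup>k\<close> has second coordinate \<open>g p\<^sup>i\<close>. A level
  \<open>(r, m, h)\<close> splits \<open>k\<close> by its residue modulo \<open>r\<close>, where \<open>e\<^sup>r \<equiv> 1\<close> modulo \<open>m\<close>. As \<open>p\<^sup>h\<close> acts
  trivially on \<open>g\<^sup>h\<close> modulo \<open>m\<close>, the second coordinate must have the same \<open>h\<close>-th power as \<open>g\<close>.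
  Taking \<open>m\<close> to be a divisor of \<open>g\<close> and \<open>h = 1\<close> tests divisibility by \<open>m\<close>; for the other moduli \<open>h\<close>
  is the order of \<open>p\<close>.\<close>

fun sieve :: "int \<Rightarrow> int \<Rightarrow> int \<Rightarrow> int \<Rightarrow> (nat \<times> int \<times> int) list \<Rightarrow> (int \<times> int) list \<Rightarrow> int \<times> int \<Rightarrow> bool" where
  "sieve D p g Q [] S e \<longleftrightarrow> S = []"
| "sieve D p g Q ((r, m, h) # ls) S e \<longleftrightarrow>
    (let e' = qpow_mod D Q e r; n = num_of h; G = pow_mod g n m in
      0 < r \<and> Q mod m = 0 \<and> qmod m e' = qmod m (1, 0) \<and> G * pow_mod p n m mod m = G \<and>
      sieve D p g Q ls (filter (passes n m G) (concat (map (orbit D Q e r) S))) e')"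

text \<open>With \<open>k = j + r * k'\<close>, each level absorbs \<open>e ^ j\<close> into the
  start list and leaves a power of the new unit \<open>e'\<close>. A genuine solution passes every
  test, so the last list could not be empty.\<close>

lemma sieve_sound:
  assumes "sieve D p g Q ls S e" "z \<in> set S"
    "qmod Q w = qmod Q (qmul D z (qpow D e k))" "snd w = g * p ^ i"
  shows False
  using assms
proof (induction ls arbitrary: S e z k)
  case (Cons l ls)
  obtain r m h where l: "l = (r, m, h)"
    by (cases l)
  define e' n G where "e' = qpow_mod D Q e r" and "n = num_of h" and "G = pow_mod g n m"
  let ?S = "filter (passes n m G) (concat (map (orbit D Q e r) S))"
  have r: "0 < r" and m: "m dvd Q" and e': "qmod m e' = qmod m (1, 0)"
    and G: "G * pow_mod p n m mod m = G" and sv: "sieve D p g Q ls ?S e'"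
    using Cons.prems(1) unfolding l by (auto simp: Let_def e'_def n_def G_def)
  define j k' where "j = k mod r" and "k' = k div r"
  have k: "k = j + r * k'"
    by (simp add: j_def k'_def)
  obtain z' where z': "z' \<in> set (orbit D Q e r z)" "qmod Q z' = qmod Q (qmul D z (qpow D e j))"
    using orbit_mem[of j r D Q e z] r unfolding j_def by (meson mod_less_divisor)
  have "qmod Q (qpow D e' k') = qmod Q (qpow D e (r * k'))"
    unfolding qpow_mult e'_def by (intro qmod_qpow_cong qpow_mod)
  then have "qmod Q (qmul D z' (qpow D e' k'))
      = qmod Q (qmul D (qmul D z (qpow D e j)) (qpow D e (r * k')))"
    by (intro qmod_qmul_cong z')
  also have "\<dots> = qmod Q (qmul D z (qpow D e k))"
    unfolding k qpow_add qmul_assoc ..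
  finally have w: "qmod Q w = qmod Q (qmul D z' (qpow D e' k'))"
    using Cons.prems(3) by simp
  \<comment> \<open>As \<open>e'\<close> is 1 modulo \<open>m\<close>, the unknown \<open>k'\<close>
    drops out and \<open>z'\<close> alone determines \<open>w\<close> modulo
    \<open>m\<close>.\<close>
  have "qmod m (qpow D e' k') = qmod m (1, 0)"
    using qmod_qpow_cong[OF e', of D k'] by simp
  then have "qmod m (qmul D z' (qpow D e' k')) = qmod m z'"
    using qmod_qmul_cong[of m z' z' _ "(1, 0)" D] by simp
  then have "qmod m w = qmod m z'"
    using qmod_dvd[OF m w] by simp
  then have "snd z' mod m = g * p ^ i mod m"
    using Cons.prems(4) by (cases z'; cases w) auto
  then have "pow_mod (snd z') n m = (g * p ^ i) ^ numeral n mod m"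
    unfolding pow_mod by (metis power_mod)
  moreover have "(g * p ^ i) ^ numeral n mod m = G"
  proof (induction i)
    case 0
    show ?case
      by (simp add: G_def pow_mod)
  next
    case (Suc i)
    have "(g * p ^ Suc i) ^ numeral n mod m = (g * p ^ i) ^ numeral n * p ^ numeral n mod m"
      by (simp add: power_mult_distrib mult_ac)
    also have "\<dots> = ((g * p ^ i) ^ numeral n mod m) * (p ^ numeral n mod m) mod m"
      by (simp add: mod_simps)
    also have "\<dots> = G"
      using Suc G by (simp add: pow_mod)
    finally show ?case .
  qed
  ultimately have "z' \<in> set ?S"
    using z'(1) Cons.prems(2) by (auto simp: passes_def)
  from Cons.IH[OF sv this w Cons.prems(4)] show False .
qed simp

definition no_solution :: "int \<Rightarrow> int \<Rightarrow> int \<Rightarrow> int \<Rightarrow> bool" where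
  "no_solution D N p g \<longleftrightarrow> (\<forall>x i. x\<^sup>2 \<noteq> D * (g * p ^ i)\<^sup>2 + N)"

lemma no_solutionI:
  assumes fund: "fundamental D N u v L"
    and pos: "0 < u \<and> 0 < v \<and> 0 < D \<and> 0 < N \<and> 0 < p \<and> 0 < g \<and> u * u = D * v * v + 1"
    and sieve: "sieve D p g Q ls (L @ map (\<lambda>(a, b). (a, - b)) L) (u, v)"
  shows "no_solution D N p g"
  unfolding no_solution_def
proof (intro allI notI)
  fix x i
  assume "x\<^sup>2 = D * (g * p ^ i)\<^sup>2 + N"
  then have eq: "\<bar>x\<bar>\<^sup>2 = D * (g * p ^ i)\<^sup>2 + N"
    by simp
  have "0 < D * (g * p ^ i)\<^sup>2 + N"
    using pos by (simp add: add_nonneg_pos)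
  then have x: "0 < \<bar>x\<bar>"
    using eq by auto
  have "u\<^sup>2 = D * v\<^sup>2 + 1"
    using pos by (simp add: power2_eq_square mult.assoc)
  from pell_descent[OF this _ _ _ _ fund eq x] pos obtain a b k where
    ab: "(a, b) \<in> set L \<or> (a, - b) \<in> set L"
    and w: "(\<bar>x\<bar>, g * p ^ i) = qmul D (a, b) (qpow D (u, v) k)"
    by auto
  have "(a, b) \<in> set (L @ map (\<lambda>(a, b). (a, - b)) L)"
    using ab by force
  from sieve_sound[OF sieve this arg_cong[where f = "qmod Q", OF w], of i] show False
    by simp
qed

subsection \<open>Searching for fundamental solutions\<close>

text \<open>To find the \<open>X\<close> for which \<open>A X\<^sup>2 + C = B W\<^sup>2\<close> is solvable, the search follows
  \<open>Z = \<lfloor>\<surd>((A X\<^sup>2 + C) / B)\<rfloor>\<close> along increasing \<open>X\<close>, keeping only \<open>p = A (2 X + 1)\<close>, \<open>q = B (2 Z + 1)\<close> and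
  the remainder \<open>r = A X\<^sup>2 + C - B Z\<^sup>2\<close>, so that each step consists of a few additions. The parameter
  \<open>s\<close> is a guess for the increment of \<open>Z\<close>; its value affects only the running time.\<close>

function adjust_down :: "int \<Rightarrow> int \<Rightarrow> int \<Rightarrow> int \<times> int" where
  "adjust_down B2 q r = (if r < 0 \<and> 0 < q \<and> 0 < B2 then adjust_down B2 (q - B2) (r + (q - B2)) else (q, r))"
  by auto
termination
  by (relation "measure (\<lambda>(B2, q, r). nat q)") auto

function adjust_up :: "int \<Rightarrow> int \<Rightarrow> int \<Rightarrow> int \<times> int" where
  "adjust_up B2 q r = (if q \<le> r \<and> 0 < q then adjust_up B2 (q + B2) (r - q) else (q, r))"
  by auto
termination
  by (relation "measure (\<lambda>(B2, q, r). nat r)") auto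

declare adjust_down.simps [simp del] adjust_up.simps [simp del]

text \<open>\<open>q\<close> is the gap \<open>B (Z + 1)^2 - B Z^2\<close>, so
  \<open>0 < r < q\<close> puts \<open>A X^2 + C\<close> strictly between consecutive values of
  \<open>B Z^2\<close>.\<close>

definition admissible :: "int list \<Rightarrow> int \<Rightarrow> int \<Rightarrow> int \<Rightarrow> bool" where
  "admissible H X q r = (if r = 0 then list_ex (\<lambda>h. X = h) H else 0 < r \<and> r < q)"

text \<open>\<open>p\<close> and \<open>s * q + t\<close> are the increments of \<open>A X^2\<close>
  and \<open>B Z^2\<close> when \<open>X\<close> grows by 1 and \<open>Z\<close> by
  \<open>s\<close>, for \<open>S = 2 B s\<close> and \<open>t = B s (s - 1)\<close>.\<close>

fun search_step :: "int \<Rightarrow> int \<Rightarrow> int \<Rightarrow> int \<Rightarrow> int \<Rightarrow> int list \<Rightarrow>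
    bool \<times> int \<times> int \<times> int \<times> int \<Rightarrow> bool \<times> int \<times> int \<times> int \<times> int" where
  "search_step A2 B2 s t S H (ok, X, p, q, r) =
    (case adjust_down B2 (q + S) (r + p - (s * q + t)) of (q1, r1) \<Rightarrow>
      case adjust_up B2 q1 r1 of (q2, r2) \<Rightarrow>
        (ok \<and> admissible H (X + 1) q2 r2, X + 1, p + A2, q2, r2))"

text \<open>Doubling keeps the natural number that drives the recursion small, as its evaluation is
  unary.\<close>

primrec iterate2 :: "nat \<Rightarrow> ('a \<Rightarrow> 'a) \<Rightarrow> 'a \<Rightarrow> 'a" where
  "iterate2 0 f x = f x"
| "iterate2 (Suc k) f x = iterate2 k f (iterate2 k f x)"

text \<open>A start at \<open>X > 0\<close> requires \<open>A (X - 1)^2 + C < 0\<close>: then no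
  smaller nonnegative value can give \<open>B W^2\<close>.\<close>

definition search :: "int \<Rightarrow> int \<Rightarrow> int \<Rightarrow> int \<Rightarrow> int list \<Rightarrow> nat \<Rightarrow> int \<Rightarrow> int \<Rightarrow> bool" where
  "search A B C s H k X Z \<longleftrightarrow>
    (let q = B * (2 * Z + 1); r = A * X * X + C - B * Z * Z in
      0 < A \<and> 0 < B \<and> 0 \<le> Z \<and> (X = 0 \<or> 0 < X \<and> A * (X - 1) * (X - 1) + C < 0) \<and>
      fst (iterate2 k (search_step (2 * A) (2 * B) s (B * s * (s - 1)) (2 * B * s) H)
        (admissible H X q r, X, A * (2 * X + 1), q, r)))"

definition solved :: "int \<Rightarrow> int \<Rightarrow> int \<Rightarrow> int list \<Rightarrow> int \<Rightarrow> bool" where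
  "solved A B C H X \<longleftrightarrow> (\<forall>W. A * X\<^sup>2 + C = B * W\<^sup>2 \<longrightarrow> X \<in> set H)"

text \<open>It suffices that the result belongs to some \<open>Z'\<close>; that \<open>Z'\<close> is
  the floor is checked by \<open>admissible\<close>.\<close>

lemma adjust_down_inv:
  assumes "q = B * (2 * Z + 1)" "r = R - B * Z\<^sup>2"
  shows "\<exists>Z'. adjust_down (2 * B) q r = (B * (2 * Z' + 1), R - B * Z'\<^sup>2)"
  using assms
proof (induction "2 * B" q r arbitrary: Z rule: adjust_down.induct)
  case (1 q r)
  show ?case
  proof (cases "r < 0 \<and> 0 < q \<and> 0 < 2 * B")
    case True
    have "q - 2 * B = B * (2 * (Z - 1) + 1)" "r + (q - 2 * B) = R - B * (Z - 1)\<^sup>2"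
      using 1(2,3) by (simp_all add: power2_eq_square algebra_simps)
    from 1(1)[OF True this] show ?thesis
      using True by (subst adjust_down.simps) simp
  next
    case False
    then show ?thesis
      using 1(2,3) by (subst adjust_down.simps) auto
  qed
qed

lemma adjust_up_inv:
  assumes "q = B * (2 * Z + 1)" "r = R - B * Z\<^sup>2"
  shows "\<exists>Z'. adjust_up (2 * B) q r = (B * (2 * Z' + 1), R - B * Z'\<^sup>2)"
  using assms
proof (induction "2 * B" q r arbitrary: Z rule: adjust_up.induct)
  case (1 q r)
  show ?case
  proof (cases "q \<le> r \<and> 0 < q")
    case True
    have "q + 2 * B = B * (2 * (Z + 1) + 1)" "r - q = R - B * (Z + 1)\<^sup>2"
      using 1(2,3) by (simp_all add: power2_eq_square algebra_simps)
    from 1(1)[OF True this] show ?thesis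
      using True by (subst adjust_up.simps) simp
  next
    case False
    then show ?thesis
      using 1(2,3) by (subst adjust_up.simps) auto
  qed
qed

lemma admissible_solved:
  assumes "admissible H X (B * (2 * Z + 1)) (A * X\<^sup>2 + C - B * Z\<^sup>2)" "0 < B"
  shows "solved A B C H X"
  unfolding solved_def
proof (intro allI impI)
  fix W
  assume W: "A * X\<^sup>2 + C = B * W\<^sup>2"
  show "X \<in> set H"
  proof (cases "A * X\<^sup>2 + C - B * Z\<^sup>2 = 0")
    case True
    then show ?thesis
      using assms(1) by (auto simp: admissible_def list_ex_iff)
  next
    case False
    then have r: "0 < A * X\<^sup>2 + C - B * Z\<^sup>2" "A * X\<^sup>2 + C - B * Z\<^sup>2 < B * (2 * Z + 1)"
      using assms(1) by (auto simp: admissible_def)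
    then have "0 < B * (2 * Z + 1)"
      by linarith
    then have Z: "0 \<le> Z"
      using assms(2) by (simp add: zero_less_mult_iff)
    have "B * Z\<^sup>2 < B * \<bar>W\<bar>\<^sup>2"
      using r(1) W by simp
    then have 1: "Z\<^sup>2 < \<bar>W\<bar>\<^sup>2"
      using assms(2) by (simp only: mult_less_cancel_left_pos)
    have "B * \<bar>W\<bar>\<^sup>2 < B * (Z + 1)\<^sup>2"
      using r(2) W by (simp add: power2_eq_square algebra_simps)
    then have 2: "\<bar>W\<bar>\<^sup>2 < (Z + 1)\<^sup>2"
      using assms(2) by (simp only: mult_less_cancel_left_pos)
    have "Z < \<bar>W\<bar>" "\<bar>W\<bar> < Z + 1"
      using power2_less_imp_less[OF 1] power2_less_imp_less[OF 2] Z by auto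
    then show ?thesis
      by simp
  qed
qed

fun search_inv :: "int \<Rightarrow> int \<Rightarrow> int \<Rightarrow> int list \<Rightarrow> int \<Rightarrow> nat \<Rightarrow> bool \<times> int \<times> int \<times> int \<times> int \<Rightarrow> bool" where
  "search_inv A B C H X0 n (ok, X, p, q, r) \<longleftrightarrow> X = X0 + int n \<and> p = A * (2 * X + 1) \<and>
    (\<exists>Z. q = B * (2 * Z + 1) \<and> r = A * X\<^sup>2 + C - B * Z\<^sup>2) \<and>
    (ok \<longrightarrow> (\<forall>i\<le>n. solved A B C H (X0 + int i)))"

lemma search_inv_step:
  assumes "search_inv A B C H X0 n st" "0 < B"
  shows "search_inv A B C H X0 (Suc n)
    (search_step (2 * A) (2 * B) s (B * s * (s - 1)) (2 * B * s) H st)"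
proof -
  obtain ok X p q r where st: "st = (ok, X, p, q, r)"
    by (cases st)
  obtain Z where X: "X = X0 + int n" and p: "p = A * (2 * X + 1)" and q: "q = B * (2 * Z + 1)"
    and r: "r = A * X\<^sup>2 + C - B * Z\<^sup>2" and ok: "ok \<longrightarrow> (\<forall>i\<le>n. solved A B C H (X0 + int i))"
    using assms(1) unfolding st by auto
  define R where "R = A * (X + 1)\<^sup>2 + C"
  have "q + 2 * B * s = B * (2 * (Z + s) + 1)" "r + p - (s * q + B * s * (s - 1)) = R - B * (Z + s)\<^sup>2"
    by (simp_all add: p q r R_def power2_eq_square algebra_simps)
  from adjust_down_inv[OF this] obtain Z1 where 1:
    "adjust_down (2 * B) (q + 2 * B * s) (r + p - (s * q + B * s * (s - 1))) = (B * (2 * Z1 + 1), R - B * Z1\<^sup>2)"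
    by blast
  obtain Z2 where 2:
    "adjust_up (2 * B) (B * (2 * Z1 + 1)) (R - B * Z1\<^sup>2) = (B * (2 * Z2 + 1), R - B * Z2\<^sup>2)"
    using adjust_up_inv by blast
  have "solved A B C H (X + 1)" if "admissible H (X + 1) (B * (2 * Z2 + 1)) (R - B * Z2\<^sup>2)"
    using admissible_solved that assms(2) unfolding R_def by blast
  then have "\<forall>i\<le>Suc n. solved A B C H (X0 + int i)"
    if "ok" "admissible H (X + 1) (B * (2 * Z2 + 1)) (R - B * Z2\<^sup>2)"
    using ok that by (auto simp: X le_Suc_eq algebra_simps)
  then show ?thesis
    unfolding st search_step.simps 1 2 prod.case search_inv.simps
    by (auto simp: X p R_def algebra_simps)
qed

lemma iterate2_invariant:
  assumes "\<And>n x. P n x \<Longrightarrow> P (Suc n) (f x)"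
  shows "P n x \<Longrightarrow> P (n + 2 ^ k) (iterate2 k f x)"
proof (induction k arbitrary: n x)
  case (Suc k)
  from Suc.IH[OF Suc.IH[OF Suc.prems]] show ?case
    by (simp add: mult_2 add.assoc)
qed (use assms in simp)

lemma search_sound:
  assumes "search A B C s H k X0 Z" and X: "0 \<le> X" "X \<le> X0 + 2 ^ k"
    and eq: "A * X\<^sup>2 + C = B * W\<^sup>2"
  shows "X \<in> set H"
proof -
  define q r where "q = B * (2 * Z + 1)" and "r = A * X0 * X0 + C - B * Z * Z"
  define st where "st = iterate2 k (search_step (2 * A) (2 * B) s (B * s * (s - 1)) (2 * B * s) H)
        (admissible H X0 q r, X0, A * (2 * X0 + 1), q, r)"
  have A: "0 < A" and B: "0 < B" and X0: "X0 = 0 \<or> 0 < X0 \<and> A * (X0 - 1) * (X0 - 1) + C < 0" and ok: "fst st"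
    using assms(1) by (simp_all add: search_def Let_def q_def r_def st_def)
  have "search_inv A B C H X0 0 (admissible H X0 q r, X0, A * (2 * X0 + 1), q, r)"
    using admissible_solved[of H X0 B Z A C] B
    by (auto simp: q_def r_def power2_eq_square mult.assoc)
  then have "search_inv A B C H X0 (0 + 2 ^ k) st"
    unfolding st_def
    by (rule iterate2_invariant[where P = "search_inv A B C H X0", rotated]) (rule search_inv_step[OF _ B])
  then have solved: "\<forall>i\<le>2 ^ k. solved A B C H (X0 + int i)"
    using ok by (cases st) auto
  have "X0 \<le> X"
  proof (rule ccontr)
    assume "\<not> X0 \<le> X"
    then have "X\<^sup>2 \<le> (X0 - 1)\<^sup>2" and neg: "A * (X0 - 1) * (X0 - 1) + C < 0"
      using X X0 by (auto intro: power_mono)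
    then have "A * X\<^sup>2 \<le> A * (X0 - 1)\<^sup>2"
      using A by simp
    then have "B * W\<^sup>2 < 0"
      using neg eq by (simp add: power2_eq_square mult.assoc)
    then show False
      using B by (simp add: mult_less_0_iff)
  qed
  then obtain i where i: "X = X0 + int i"
    by (metis zle_iff_zadd)
  then have "int i \<le> int (2 ^ k)"
    using X by simp
  then have "i \<le> 2 ^ k"
    by (simp only: of_nat_le_iff)
  then have "solved A B C H X"
    using solved i by simp
  then show ?thesis
    using eq unfolding solved_def by blast
qed

section \<open>Certified lists of fundamental solutions\<close>

definition norm_list :: "int \<Rightarrow> int \<Rightarrow> int \<Rightarrow> (int \<times> int) list \<Rightarrow> bool" where
  "norm_list A B N L \<longleftrightarrow> list_all (\<lambda>(x, y). 0 < x \<and> 0 \<le> y \<and> A * x * x = B * y * y + N) L"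

lemma norm_list_unique:
  assumes "norm_list A B N L" "(x, y) \<in> set L" "A * x\<^sup>2 = B * y\<^sup>2 + N" "0 < A" "0 < B"
  shows "0 < x'  \<Longrightarrow> A * x'\<^sup>2 = B * y\<^sup>2 + N \<Longrightarrow> x' = x"
    and "0 \<le> y' \<Longrightarrow> A * x\<^sup>2 = B * y'\<^sup>2 + N \<Longrightarrow> y' = y"
proof -
  have pos: "0 < x" "0 \<le> y"
    using assms(1,2) by (auto simp: norm_list_def list_all_iff)
  show "x' = x" if "0 < x'" "A * x'\<^sup>2 = B * y\<^sup>2 + N"
  proof -
    have "A * x'\<^sup>2 = A * x\<^sup>2"
      using that assms(3) by linarith
    then show ?thesis
      using that pos assms(4) by (auto intro: power2_eq_imp_eq)
  qed
  show "y' = y" if "0 \<le> y'" "A * x\<^sup>2 = B * y'\<^sup>2 + N"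
  proof -
    have "B * y'\<^sup>2 = B * y\<^sup>2"
      using that assms(3) by linarith
    then show ?thesis
      using that pos assms(5) by (auto intro: power2_eq_imp_eq)
  qed
qed

text \<open>The threshold forces \<open>y \<le> 2 ^ k\<close>, the range covered by the search for
  squares \<open>D y^2 + N\<close>.\<close>

lemma fundamentalI:
  assumes norm: "norm_list 1 D N L" and "search D 1 N s (map snd L) k 0 Z"
    and bound: "0 < D \<and> 0 < u \<and> v * v * N < 2 * (u + 1) * ((2 ^ k + 1) * (2 ^ k + 1))"
  shows "fundamental D N u v L"
  unfolding fundamental_def
proof (intro allI impI)
  fix x y
  assume x: "0 < x" and y: "0 \<le> y" and eq: "x\<^sup>2 = D * y\<^sup>2 + N" and le: "2 * (u + 1) * y\<^sup>2 \<le> v\<^sup>2 * N"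
  have "v\<^sup>2 * N < 2 * (u + 1) * (2 ^ k + 1)\<^sup>2"
    using bound by (simp only: power2_eq_square)
  with le have "2 * (u + 1) * y\<^sup>2 < 2 * (u + 1) * (2 ^ k + 1)\<^sup>2"
    by (rule le_less_trans)
  moreover have "0 < 2 * (u + 1)"
    using bound by simp
  ultimately have "y\<^sup>2 < (2 ^ k + 1)\<^sup>2"
    by (simp only: mult_less_cancel_left_pos)
  then have "y < 2 ^ k + 1"
    by (rule power2_less_imp_less) simp
  then have "y \<in> set (map snd L)"
    using search_sound[OF assms(2) y, of x] eq by simp
  then obtain x0 where x0: "(x0, y) \<in> set L"
    by auto
  then have "x0\<^sup>2 = D * y\<^sup>2 + N"
    using norm by (auto simp: norm_list_def list_all_iff power2_eq_square mult.assoc)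
  then have "x = x0"
    using norm_list_unique(1)[OF norm x0] x eq bound by simp
  then show "(x, y) \<in> set L"
    using x0 by simp
qed

text \<open>The unit is the square of \<open>\<eta> = s \<surd>d\<^sub>1 + t \<surd>d\<^sub>2\<close>. Dividing \<open>x + y \<surd>D\<close> by \<open>\<eta>\<close> leads to the equation
  \<open>d\<^sub>1 x\<^sup>2 - d\<^sub>2 y\<^sup>2 = N\<close>, in which large fundamental solutions of the original equation become small, so
  that two searches of length about \<open>\<surd>\<eta>\<close> replace one of length about \<open>\<eta>\<close>.\<close>

lemma fundamentalI_half:
  fixes d1 d2 s t N w :: int
  assumes norm1: "norm_list 1 D N L1" and norm2: "norm_list d1 d2 N L2"
    and search1: "search D 1 N s1 (map snd L1) k1 0 Z1"
    and search2: "search d1 d2 (- N) s2 (map fst L2) k2 X0 Z2"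
    and half: "0 < d1 \<and> 0 < d2 \<and> 0 < s \<and> 0 < t \<and> 0 < N \<and> 0 \<le> X0 \<and> D = d1 * d2 \<and>
      d1 * s * s - d2 * t * t = 1 \<and> u = 2 * d1 * s * s - 1 \<and> v = 2 * s * t"
    and bound: "0 \<le> w \<and> d2 * w * w \<le> d1 * ((X0 + 2 ^ k2 + 1) * (X0 + 2 ^ k2 + 1)) - N \<and>
      s * s * N - (X0 + 2 ^ k2 + 1) * (X0 + 2 ^ k2 + 1) < (2 ^ k1 + 1) * d2 * (t * (X0 + 2 ^ k2 + 1) + s * w)"
    and L: "L = L1 @ map (\<lambda>(x, y). (d1 * s * x - d2 * t * y, t * x - s * y)) L2"
  shows "fundamental D N u v L"
  unfolding fundamental_def
proof (intro allI impI)
  fix x y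
  assume x: "0 < x" and y: "0 \<le> y" and eq: "x\<^sup>2 = D * y\<^sup>2 + N" and le: "2 * (u + 1) * y\<^sup>2 \<le> v\<^sup>2 * N"
  have pos: "0 < d1" "0 < d2" "0 < s" "0 < t" "0 < N" and D: "D = d1 * d2"
    and st: "d1 * s\<^sup>2 = d2 * t\<^sup>2 + 1" and u: "u + 1 = 2 * d1 * s\<^sup>2" and v: "v = 2 * s * t"
    using half by (simp_all add: power2_eq_square mult.assoc)
  \<comment> \<open>\<open>x'\<close> and \<open>- y'\<close> are the coordinates of
    \<open>(x + y \<surd>D) / \<eta>\<close> with respect to \<open>\<surd>d1\<close> and
    \<open>\<surd>d2\<close>. The threshold on \<open>y\<close> turns out to say
    \<open>0 \<le> y'\<close>.\<close>
  define x' y' where "x' = s * x - d2 * t * y" and "y' = t * x - d1 * s * y"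
  have "d1 * x'\<^sup>2 - d2 * y'\<^sup>2 = (d1 * s\<^sup>2 - d2 * t\<^sup>2) * (x\<^sup>2 - D * y\<^sup>2)"
    by (simp add: D x'_def y'_def power2_eq_square algebra_simps)
  then have eq': "d1 * x'\<^sup>2 = d2 * y'\<^sup>2 + N"
    using st eq by simp
  have inverse: "d1 * s * x' - d2 * t * y' = x" "t * x' - s * y' = y"
  proof -
    have "d1 * s * x' - d2 * t * y' = (d1 * s\<^sup>2 - d2 * t\<^sup>2) * x" "t * x' - s * y' = (d1 * s\<^sup>2 - d2 * t\<^sup>2) * y"
      by (simp_all add: x'_def y'_def power2_eq_square algebra_simps)
    then show "d1 * s * x' - d2 * t * y' = x" "t * x' - s * y' = y"
      using st by simp_all
  qed
  have "(4 * s\<^sup>2) * (d1 * y\<^sup>2) \<le> (4 * s\<^sup>2) * (t\<^sup>2 * N)"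
    using le unfolding u v by (simp add: power2_eq_square algebra_simps)
  then have "d1 * y\<^sup>2 \<le> t\<^sup>2 * N"
    using pos by simp
  moreover have "(t * x)\<^sup>2 - (d1 * s * y)\<^sup>2 = t\<^sup>2 * (D * y\<^sup>2 + N) - d1 * (d2 * t\<^sup>2 + 1) * y\<^sup>2"
    unfolding eq[symmetric] st[symmetric] by (simp add: power2_eq_square algebra_simps)
  then have "(t * x)\<^sup>2 - (d1 * s * y)\<^sup>2 = t\<^sup>2 * N - d1 * y\<^sup>2"
    by (simp add: D algebra_simps)
  ultimately have "(d1 * s * y)\<^sup>2 \<le> (t * x)\<^sup>2"
    by linarith
  then have "d1 * s * y \<le> t * x"
    using pos x by (intro power2_le_imp_le[of "d1 * s * y"]) auto
  then have y': "0 \<le> y'"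
    by (simp add: y'_def)
  have "0 < s * x'"
  proof -
    have "d2 * t * y' \<ge> 0"
      using pos y' by simp
    then have "0 < d1 * (s * x')"
      using inverse(1) x by (simp add: mult.assoc)
    then show ?thesis
      using pos by (simp add: zero_less_mult_iff)
  qed
  then have x': "0 < x'"
    using pos by (simp add: zero_less_mult_iff)
  show "(x, y) \<in> set L"
  proof (cases "y \<le> 2 ^ k1")
    case True
    then have "y \<in> set (map snd L1)"
      using search_sound[OF search1 y, of x] eq by simp
    then obtain x0 where x0: "(x0, y) \<in> set L1"
      by auto
    then have "x0\<^sup>2 = D * y\<^sup>2 + N"
      using norm1 by (auto simp: norm_list_def list_all_iff power2_eq_square mult.assoc)
    then have "x = x0"
      using norm_list_unique(1)[OF norm1 x0] x eq pos D by simp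
    then show ?thesis
      using x0 by (simp add: L)
  next
    case False
    have "x' \<le> X0 + 2 ^ k2"
    proof (rule ccontr)
      define X where "X = X0 + 2 ^ k2 + 1"
      assume "\<not> x' \<le> X0 + 2 ^ k2"
      then have X: "X \<le> x'" and X_pos: "0 < X"
        using half by (auto simp: X_def intro: add_nonneg_pos)
      have w: "0 \<le> w" "d2 * w\<^sup>2 \<le> d1 * X\<^sup>2 - N"
        and bnd: "s\<^sup>2 * N - X\<^sup>2 < (2 ^ k1 + 1) * d2 * (t * X + s * w)"
        using bound by (simp_all add: X_def power2_eq_square mult.assoc)
      have X2: "X\<^sup>2 \<le> x'\<^sup>2"
        using X X_pos by (intro power_mono) auto
      then have "d1 * X\<^sup>2 \<le> d1 * x'\<^sup>2"
        using pos by simp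
      \<comment> \<open>\<open>w\<close> is an integer lower bound for the value of
        \<open>y'\<close> that belongs to \<open>x' = X\<close>.\<close>
      then have "d2 * w\<^sup>2 \<le> d2 * y'\<^sup>2"
        using w(2) eq' by linarith
      then have "w\<^sup>2 \<le> y'\<^sup>2"
        using pos by simp
      then have wy: "w \<le> y'"
        using y' by (rule power2_le_imp_le)
      \<comment> \<open>Since \<open>y = t x' - s y'\<close>, the product
        \<open>d2 y (t x' + s y')\<close> equals \<open>s^2 N - x'^2\<close>; hence \<open>y\<close>
        and \<open>x'\<close> cannot both be large.\<close>
      have "(2 ^ k1 + 1) * d2 * (t * X + s * w) \<le> y * d2 * (t * x' + s * y')"
        using False pos X X_pos w(1) wy y
        by (intro mult_mono add_mono mult_left_mono add_nonneg_nonneg mult_nonneg_nonneg) auto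
      also have "\<dots> = d2 * (t * x')\<^sup>2 - s\<^sup>2 * (d2 * y'\<^sup>2)"
        unfolding inverse(2)[symmetric] by (simp add: power2_eq_square algebra_simps)
      also have "d2 * y'\<^sup>2 = d1 * x'\<^sup>2 - N"
        using eq' by simp
      also have "d2 * (t * x')\<^sup>2 - s\<^sup>2 * (d1 * x'\<^sup>2 - N) = s\<^sup>2 * N - (d1 * s\<^sup>2 - d2 * t\<^sup>2) * x'\<^sup>2"
        by (simp add: power2_eq_square algebra_simps)
      also have "\<dots> = s\<^sup>2 * N - x'\<^sup>2"
        using st by simp
      also have "\<dots> \<le> s\<^sup>2 * N - X\<^sup>2"
        using X2 by simp
      finally show False
        using bnd by simp
    qed
    moreover have "d1 * x'\<^sup>2 + - N = d2 * y'\<^sup>2"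
      using eq' by simp
    ultimately have "x' \<in> set (map fst L2)"
      using search_sound[OF search2, of x' y'] x' by simp
    then obtain y0 where y0: "(x', y0) \<in> set L2"
      by auto
    then have "d1 * x'\<^sup>2 = d2 * y0\<^sup>2 + N"
      using norm2 by (auto simp: norm_list_def list_all_iff power2_eq_square mult.assoc)
    then have "y' = y0"
      using norm_list_unique(2)[OF norm2 y0] y' eq' pos by simp
    then have "(x', y') \<in> set L2"
      using y0 by simp
    then have "(d1 * s * x' - d2 * t * y', t * x' - s * y') \<in> set L"
      by (force simp: L)
    then show ?thesis
      unfolding inverse .
  qed
qed

subsection \<open>Determining all exponents\<close>

function floor_root :: "int \<Rightarrow> int" where
  "floor_root n = (if n \<le> 0 then 0
     else let r = 2 * floor_root (n div 4) in if (r + 1) * (r + 1) \<le> n then r + 1 else r)"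
  by auto
termination
  by (relation "measure nat") auto

declare floor_root.simps [simp del]

text \<open>If \<open>r\<close> is the floor of the root of \<open>n div 4\<close>, then
  \<open>(2 r)^2 \<le> n < (2 r + 2)^2\<close>, which leaves two candidates.\<close>

lemma floor_root_bounds:
  assumes "0 \<le> n"
  shows "0 \<le> floor_root n \<and> floor_root n * floor_root n \<le> n \<and> n < (floor_root n + 1) * (floor_root n + 1)"
  using assms
proof (induction n rule: floor_root.induct)
  case (1 n)
  show ?case
  proof (cases "n = 0")
    case False
    define r where "r = floor_root (n div 4)"
    have IH: "0 \<le> r" "r * r \<le> n div 4" "n div 4 < (r + 1) * (r + 1)"
      using 1 False by (simp_all add: r_def)
    then have "4 * (r * r) \<le> n" "n < 4 * ((r + 1) * (r + 1))"
      by linarith+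
    moreover have "floor_root n = (if (2 * r + 1) * (2 * r + 1) \<le> n then 2 * r + 1 else 2 * r)"
      using 1 False by (subst floor_root.simps) (simp add: r_def Let_def)
    ultimately show ?thesis
      using IH(1) by (auto simp: algebra_simps)
  qed (simp add: floor_root.simps)
qed

definition is_square_int :: "int \<Rightarrow> bool" where
  "is_square_int n = (let r = floor_root n in r * r = n)"

lemma is_square_int_iff:
  assumes "0 \<le> n"
  shows "is_square_int n \<longleftrightarrow> (\<exists>x. x\<^sup>2 = n)"
proof
  assume "\<exists>x. x\<^sup>2 = n"
  then obtain x where x: "\<bar>x\<bar>\<^sup>2 = n"
    by auto
  have "(floor_root n)\<^sup>2 < (\<bar>x\<bar> + 1)\<^sup>2" "\<bar>x\<bar>\<^sup>2 < (floor_root n + 1)\<^sup>2"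
  proof -
    show "\<bar>x\<bar>\<^sup>2 < (floor_root n + 1)\<^sup>2"
      using floor_root_bounds[OF assms] x by (simp add: power2_eq_square)
    have "\<bar>x\<bar>\<^sup>2 < (\<bar>x\<bar> + 1)\<^sup>2"
      by (intro power_strict_mono) auto
    then show "(floor_root n)\<^sup>2 < (\<bar>x\<bar> + 1)\<^sup>2"
      using floor_root_bounds[OF assms] x by (simp add: power2_eq_square)
  qed
  from power2_less_imp_less[OF this(1)] power2_less_imp_less[OF this(2)]
  have "floor_root n = \<bar>x\<bar>"
    using floor_root_bounds[OF assms] by simp
  then show "is_square_int n"
    using x by (simp add: is_square_int_def power2_eq_square)
qed (auto simp: is_square_int_def Let_def power2_eq_square)

lemma no_solution_exponent:
  fixes a b c x n m r :: nat and N g f :: int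
  assumes nosol: "no_solution (int (a * b ^ r)) N (int b) g"
    and N: "f * f * N = int c" and f: "0 < f" and m: "int b ^ m = f * g"
    and n: "2 * m + r \<le> n" "n mod 2 = r"
  shows "x\<^sup>2 \<noteq> a * b ^ n + c"
proof
  assume eq: "x\<^sup>2 = a * b ^ n + c"
  have "2 * (n div 2) + r = n"
    using n(2) by presburger
  with n(1) obtain i where i: "n div 2 = m + i"
    using le_Suc_ex[of m "n div 2"] by auto
  then have n_eq: "n = r + (m + i) * 2"
    using \<open>2 * (n div 2) + r = n\<close> by simp
  have "int b ^ n = int b ^ r * (int b ^ m * int b ^ i)\<^sup>2"
    unfolding n_eq power_add power_mult ..
  then have bn: "int b ^ n = int b ^ r * (f * (g * int b ^ i))\<^sup>2"
    by (simp add: m mult.assoc)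
  have "(int x)\<^sup>2 = int (a * b ^ n + c)"
    unfolding eq[symmetric] by simp
  also have "\<dots> = f\<^sup>2 * (int (a * b ^ r) * (g * int b ^ i)\<^sup>2 + N)"
    unfolding N[symmetric] of_nat_add of_nat_mult of_nat_power bn
    by (simp add: power_mult_distrib power2_eq_square algebra_simps flip: N)
  finally have sq: "(int x)\<^sup>2 = f\<^sup>2 * (int (a * b ^ r) * (g * int b ^ i)\<^sup>2 + N)" .
  then have "f\<^sup>2 dvd (int x)\<^sup>2"
    by simp
  then obtain y where "int x = f * y"
    by (auto simp: pow_divides_pow_iff elim: dvdE)
  then have "y\<^sup>2 = int (a * b ^ r) * (g * int b ^ i)\<^sup>2 + N"
    using sq f by (simp add: power_mult_distrib)
  then show False
    using nosol unfolding no_solution_def by blast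
qed

text \<open>\<open>A\<close>, \<open>B\<close>, \<open>C\<close> repeat the coefficients as
  integers, so that evaluating \<open>small\<close> avoids large numbers of type \<open>nat\<close>,
  which would be unary.\<close>

lemma solutions_eqI:
  fixes a b c m0 m1 M :: nat and N g0 g1 f A B C :: int
  assumes even: "no_solution (int (a * b ^ 0)) N (int b) g0"
    and odd: "no_solution (int (a * b ^ 1)) N (int b) g1"
    and f: "0 < f" "f * f * N = int c"
    and m: "int b ^ m0 = f * g0" "int b ^ m1 = f * g1" "2 * m0 \<le> M" "2 * m1 \<le> M"
    and small: "filter (\<lambda>n. is_square_int (A * B ^ n + C)) [0..<M] = ns"
    and ABC: "A = int a" "B = int b" "C = int c"
  shows "card (solutions a b c) = length ns \<and> snd ` solutions a b c = set ns"
proof -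
  have large: "x\<^sup>2 \<noteq> a * b ^ n + c" if "M \<le> n" for x n
  proof (cases "n mod 2 = 0")
    case True
    show ?thesis
      using no_solution_exponent[OF even f(2,1) m(1) _ True] that m(3) by simp
  next
    case False
    then have 1: "n mod 2 = 1"
      by simp
    \<comment> \<open>\<open>n\<close> is odd, so \<open>2 * m1 \<le> n\<close> already yields the
      extra 1.\<close>
    have "2 * m1 + 1 \<le> n"
      using m(4) that 1 by presburger
    from no_solution_exponent[OF odd f(2,1) m(2) this 1] show ?thesis .
  qed
  have square: "is_square_int (A * B ^ n + C) \<longleftrightarrow> (\<exists>x. x\<^sup>2 = a * b ^ n + c)" for n
  proof -
    have "(\<exists>x. x\<^sup>2 = int (a * b ^ n + c)) \<longleftrightarrow> (\<exists>x. x\<^sup>2 = a * b ^ n + c)"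
    proof
      assume "\<exists>x. x\<^sup>2 = int (a * b ^ n + c)"
      then obtain x where "x\<^sup>2 = int (a * b ^ n + c)" ..
      then have "int ((nat \<bar>x\<bar>)\<^sup>2) = int (a * b ^ n + c)"
        by simp
      then show "\<exists>x. x\<^sup>2 = a * b ^ n + c"
        by (simp only: of_nat_eq_iff) blast
    qed (metis of_nat_power)
    then show ?thesis
      using is_square_int_iff[of "A * B ^ n + C"] by (simp add: ABC)
  qed
  have snd: "snd ` solutions a b c = set ns"
  proof -
    have "n \<in> snd ` solutions a b c \<longleftrightarrow> n \<in> set ns" for n
    proof -
      have "n \<in> snd ` solutions a b c \<longleftrightarrow> (\<exists>x. x\<^sup>2 = a * b ^ n + c)"
        by (force simp: solutions_def)
      also have "\<dots> \<longleftrightarrow> n \<in> set ns"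
        using large[of n] unfolding small[symmetric] square[symmetric] by (auto simp: square not_less[symmetric])
      finally show ?thesis .
    qed
    then show ?thesis
      by blast
  qed
  \<comment> \<open>As \<open>x\<close> is nonnegative, \<open>n\<close> determines it, so counting
    solutions amounts to counting exponents.\<close>
  have "inj_on snd (solutions a b c)"
    by (auto simp: inj_on_def solutions_def) (metis power2_eq_imp_eq zero_le)
  then have "card (solutions a b c) = card (set ns)"
    using card_image snd by metis
  also have "\<dots> = length ns"
    unfolding small[symmetric] by (intro distinct_card distinct_filter) simp
  finally show ?thesis
    using snd by blast
qed

subsection \<open>The individual equations\<close>

text \<open>In the direct searches here and below, \<open>Z\<close> and \<open>s\<close> are the
  floors of \<open>\<surd>N\<close> and \<open>\<surd>D\<close>, and \<open>Q\<close> is the least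
  common multiple of the moduli. Here the modulus 431 removes the classes left by divisibility by
  81.\<close>

lemma no_solution_28_37: "no_solution 28 37 3 81"
  by (rule no_solutionI[OF fundamentalI[where L = "[(17, 3)]"
        and u = 127 and v = 24 and k = 4 and Z = 6 and s = 5],
        where Q = 34911 and ls = "[(3, 9, 1), (3, 27, 1), (3, 81, 1), (2, 431, 43)]"]; code_simp)

text \<open>The unit is 1 modulo 3, so \<open>y\<close> stays 1 or -1 modulo 3.\<close>

lemma no_solution_84_37: "no_solution 84 37 3 3"
  by (rule no_solutionI[OF fundamentalI[where L = "[(11, 1)]"
        and u = 55 and v = 6 and k = 2 and Z = 6 and s = 9],
        where Q = 3 and ls = "[(1, 3, 1)]"]; code_simp)

lemma no_solution_70_46: "no_solution 70 46 3 81"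
  by (rule no_solutionI[OF fundamentalI[where L = "[(26, 3)]"
        and u = 251 and v = 30 and k = 4 and Z = 6 and s = 8],
        where Q = 21951 and ls = "[(2, 3, 1), (3, 9, 1), (3, 27, 1), (3, 81, 1), (1, 271, 30)]"]; code_simp)

lemma no_solution_210_46: "no_solution 210 46 3 9"
  by (rule no_solutionI[OF fundamentalI[where L = "[(16, 1)]"
        and u = 29 and v = 2 and k = 0 and Z = 6 and s = 14],
        where Q = 1629 and ls = "[(6, 3, 1), (3, 9, 1), (1, 181, 45)]"]; code_simp)

lemma no_solution_130_94: "no_solution 130 94 3 81"
  by (rule no_solutionI[OF fundamentalI[where L = "[(308, 27)]"
        and u = 6499 and v = 570 and k = 6 and Z = 9 and s = 11],
        where Q = 9404181 and ls = "[(3, 9, 1), (3, 27, 1), (3, 81, 1), (1, 116101, 225)]"]; code_simp)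

lemma no_solution_390_94: "no_solution 390 94 3 27"
  by (rule no_solutionI[OF fundamentalI[where L = "[(22, 1)]"
        and u = 79 and v = 4 and k = 2 and Z = 9 and s = 19],
        where Q = 622539 and ls = "[(3, 3, 1), (3, 9, 1), (3, 27, 1), (2, 23057, 2096)]"]; code_simp)

lemma no_solution_148_517: "no_solution 148 517 3 9"
  by (rule no_solutionI[OF fundamentalI[where L = "[(43, 3)]"
        and u = 73 and v = 6 and k = 4 and Z = 22 and s = 12],
        where Q = 3298599 and ls = "[(3, 9, 1), (5, 366511, 24434)]"]; code_simp)

lemma no_solution_444_517: "no_solution 444 517 3 2187"
  by (rule no_solutionI[OF fundamentalI[where L = "[(31, 1), (191, 9)]"
        and u = 295 and v = 14 and k = 4 and Z = 22 and s = 21],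
        where Q = 38265939 and ls = "[(3, 3, 1), (3, 9, 1), (3, 27, 1), (3, 81, 1), (3, 243, 1), (3, 729, 1), (3, 2187, 1), (4, 17497, 729)]"]; code_simp)

text \<open>\<open>t = 9 * 901499\<close>, so the unit is 1 modulo 901499 and \<open>y\<close> keeps
  the residue of a fundamental solution up to sign. \<open>X0\<close> is the least \<open>X\<close>
  with \<open>d1 X^2 \<ge> N\<close>.\<close>

lemma no_solution_8740_8749: "no_solution 8740 8749 3 1"
  by (rule no_solutionI[OF fundamentalI_half[where ?L1.0 = "[]" and ?L2.0 = "[(8, 33), (8884, 43713)]"
        and L = "[(980951383, 10492809), (811943, 8685)]"
        and u = 2501491975869079 and v = 26757368380026 and ?d1.0 = 460 and s = 1648943 and ?d2.0 = 19 and t = 8113491 and w = 80645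
        and ?k1.0 = 13 and ?Z1.0 = 93 and ?s1.0 = 93 and ?k2.0 = 14 and ?X0.0 = 5 and ?Z2.0 = 12 and ?s2.0 = 4],
        where Q = 901499 and ls = "[(1, 901499, 34673)]"]; code_simp)

lemma no_solution_26220_8749: "no_solution 26220 8749 3 177147"
  by (rule no_solutionI[OF fundamentalI[where L = "[(187, 1), (4373, 27)]"
        and u = 9557191 and v = 59022 and k = 11 and Z = 93 and s = 161],
        where Q = 9298268883 and ls = "[(3, 81, 1), (3, 243, 1), (3, 729, 1), (3, 2187, 1), (3, 6561, 1), (3, 19683, 1), (3, 59049, 1), (3, 177147, 1), (1, 52489, 2187)]"]; code_simp)

lemma no_solution_6_19: "no_solution 6 19 5 25"
  by (rule no_solutionI[OF fundamentalI[where L = "[(5, 1)]"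
        and u = 5 and v = 2 and k = 1 and Z = 4 and s = 2],
        where Q = 2725 and ls = "[(4, 5, 1), (5, 25, 1), (1, 109, 27)]"]; code_simp)

lemma no_solution_30_19: "no_solution 30 19 5 125"
  by (rule no_solutionI[OF fundamentalI[where L = "[(7, 1)]"
        and u = 11 and v = 2 and k = 0 and Z = 4 and s = 5],
        where Q = 687625 and ls = "[(5, 5, 1), (5, 25, 1), (5, 125, 1), (2, 5501, 2750)]"]; code_simp)

lemma no_solution_14_11: "no_solution 14 11 5 25"
  by (rule no_solutionI[OF fundamentalI[where L = "[(5, 1)]"
        and u = 15 and v = 4 and k = 1 and Z = 3 and s = 3],
        where Q = 1525 and ls = "[(4, 5, 1), (5, 25, 1), (1, 61, 30)]"]; code_simp)

lemma no_solution_70_11: "no_solution 70 11 5 5"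
  by (rule no_solutionI[OF fundamentalI[where L = "[(9, 1)]"
        and u = 251 and v = 30 and k = 2 and Z = 3 and s = 8],
        where Q = 5 and ls = "[(1, 5, 1)]"]; code_simp)

text \<open>Divisibility of \<open>y\<close> by 24 is already impossible.\<close>

lemma no_solution_248_23161: "no_solution 248 23161 6 216"
  by (rule no_solutionI[OF fundamentalI[where L = "[(153, 1), (219, 10), (281, 15), (587, 36)]"
        and u = 63 and v = 4 and k = 6 and Z = 152 and s = 15],
        where Q = 24 and ls = "[(2, 4, 1), (1, 8, 1), (2, 3, 1)]"]; code_simp)

lemma no_solution_1488_23161: "no_solution 1488 23161 6 216"
  by (rule no_solutionI[OF fundamentalI[where L = "[(157, 1), (277, 6), (1397, 36), (5981, 155)]"
        and u = 12151 and v = 315 and k = 9 and Z = 152 and s = 38],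
        where Q = 20952 and ls = "[(2, 2, 1), (2, 4, 1), (2, 8, 1), (3, 27, 1), (2, 97, 12)]"]; code_simp)

lemma no_solution_1513_1661497: "no_solution 1513 1661497 6 2592"
  by (rule no_solutionI[OF fundamentalI_half[where ?L1.0 = "[(3083, 72), (16853, 432), (228253, 5868)]" and ?L2.0 = "[(813, 328)]"
        and L = "[(3083, 72), (16853, 432), (228253, 5868), (27203683, 699372)]"
        and u = 22280499233 and v = 572803224 and ?d1.0 = 17 and s = 25599 and ?d2.0 = 89 and t = 11188 and w = 7296
        and ?k1.0 = 15 and ?Z1.0 = 1288 and ?s1.0 = 38 and ?k2.0 = 14 and ?X0.0 = 313 and ?Z2.0 = 6 and ?s2.0 = 0],
        where Q = 6161184 and ls = "[(2, 16, 1), (2, 32, 1), (3, 9, 1), (3, 27, 1), (3, 81, 1), (2, 2377, 594)]"]; code_simp)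

text \<open>The level for 5 has \<open>h = 1\<close> because 6 is 1 modulo 5: it demands that
  \<open>y\<close> be 2 modulo 5.\<close>

lemma no_solution_9078_1661497: "no_solution 9078 1661497 6 72"
  by (rule no_solutionI[OF fundamentalI_half[where ?L1.0 = "[(1303, 2), (1723, 12), (7355, 76)]" and ?L2.0 = "[(39, 1619), (95, 4433), (479, 22801), (665, 31667), (919, 43771)]"
        and L = "[(1303, 2), (1723, 12), (7355, 76), (4985545, 52326), (1934917, 20308), (379973, 3988), (273643, 2872), (197993, 2078)]"
        and u = 435389957 and v = 4569654 and ?d1.0 = 4539 and s = 219 and ?d2.0 = 2 and t = 10433 and w = 98561
        and ?k1.0 = 10 and ?Z1.0 = 1288 and ?s1.0 = 95 and ?k2.0 = 11 and ?X0.0 = 20 and ?Z2.0 = 277 and ?s2.0 = 47],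
        where Q = 360 and ls = "[(2, 4, 1), (2, 8, 1), (3, 9, 1), (1, 5, 1)]"]; code_simp)

text \<open>\<open>m0\<close> and \<open>m1\<close> exclude even \<open>n\<close> from 12 and odd
  \<open>n\<close> from 7 on, just beyond the known 10 and 5.\<close>

lemma solutions_28:
  "card (solutions 28 3 2997) = 5 \<and> snd ` solutions 28 3 2997 = {0, 2, 5, 6, 10}"
proof -
  let ?ns = "[0 :: nat, 2, 5, 6, 10]"
  have "filter (\<lambda>n. is_square_int (28 * 3 ^ n + 2997)) [0..<12] = ?ns"
    by code_simp
  then have "card (solutions 28 3 2997) = length ?ns \<and>
      snd ` solutions 28 3 2997 = set ?ns"
    using no_solution_28_37 no_solution_84_37
    by (intro solutions_eqI[where N = 37 and f = 9 and ?m0.0 = 6 and ?g0.0 = 81 and ?m1.0 = 3 and ?g1.0 = 3])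
      simp_all
  then show ?thesis
    by simp
qed

lemma solutions_70:
  "card (solutions 70 3 414) = 5 \<and> snd ` solutions 70 3 414 = {0, 3, 4, 5, 8}"
proof -
  let ?ns = "[0 :: nat, 3, 4, 5, 8]"
  have "filter (\<lambda>n. is_square_int (70 * 3 ^ n + 414)) [0..<10] = ?ns"
    by code_simp
  then have "card (solutions 70 3 414) = length ?ns \<and>
      snd ` solutions 70 3 414 = set ?ns"
    using no_solution_70_46 no_solution_210_46
    by (intro solutions_eqI[where N = 46 and f = 3 and ?m0.0 = 5 and ?g0.0 = 81 and ?m1.0 = 3 and ?g1.0 = 9])
      simp_all
  then show ?thesis
    by simp
qed

lemma solutions_130:
  "card (solutions 130 3 5550606) = 5 \<and> snd ` solutions 130 3 5550606 = {0, 6, 11, 15, 16}"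
proof -
  let ?ns = "[0 :: nat, 6, 11, 15, 16]"
  have "filter (\<lambda>n. is_square_int (130 * 3 ^ n + 5550606)) [0..<18] = ?ns"
    by code_simp
  then have "card (solutions 130 3 5550606) = length ?ns \<and>
      snd ` solutions 130 3 5550606 = set ?ns"
    using no_solution_130_94 no_solution_390_94
    by (intro solutions_eqI[where N = 94 and f = 243 and ?m0.0 = 9 and ?g0.0 = 81 and ?m1.0 = 8 and ?g1.0 = 27])
      simp_all
  then show ?thesis
    by simp
qed

lemma solutions_148:
  "card (solutions 148 3 41877) = 5 \<and> snd ` solutions 148 3 41877 = {0, 5, 6, 9, 17}"
proof -
  let ?ns = "[0 :: nat, 5, 6, 9, 17]"
  have "filter (\<lambda>n. is_square_int (148 * 3 ^ n + 41877)) [0..<18] = ?ns"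
    by code_simp
  then have "card (solutions 148 3 41877) = length ?ns \<and>
      snd ` solutions 148 3 41877 = set ?ns"
    using no_solution_148_517 no_solution_444_517
    by (intro solutions_eqI[where N = 517 and f = 9 and ?m0.0 = 4 and ?g0.0 = 9 and ?m1.0 = 9 and ?g1.0 = 2187])
      simp_all
  then show ?thesis
    by simp
qed

lemma solutions_8740:
  "card (solutions 8740 3 57402189) = 5 \<and> snd ` solutions 8740 3 57402189 = {0, 4, 9, 15, 29}"
proof -
  let ?ns = "[0 :: nat, 4, 9, 15, 29]"
  have "filter (\<lambda>n. is_square_int (8740 * 3 ^ n + 57402189)) [0..<30] = ?ns"
    by code_simp
  then have "card (solutions 8740 3 57402189) = length ?ns \<and>
      snd ` solutions 8740 3 57402189 = set ?ns"
    using no_solution_8740_8749 no_solution_26220_8749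
    by (intro solutions_eqI[where N = 8749 and f = 81 and ?m0.0 = 4 and ?g0.0 = 1 and ?m1.0 = 15 and ?g1.0 = 177147])
      simp_all
  then show ?thesis
    by simp
qed

lemma solutions_6:
  "card (solutions 6 5 11875) = 5 \<and> snd ` solutions 6 5 11875 = {0, 4, 5, 6, 9}"
proof -
  let ?ns = "[0 :: nat, 4, 5, 6, 9]"
  have "filter (\<lambda>n. is_square_int (6 * 5 ^ n + 11875)) [0..<10] = ?ns"
    by code_simp
  then have "card (solutions 6 5 11875) = length ?ns \<and>
      snd ` solutions 6 5 11875 = set ?ns"
    using no_solution_6_19 no_solution_30_19
    by (intro solutions_eqI[where N = 19 and f = 25 and ?m0.0 = 4 and ?g0.0 = 25 and ?m1.0 = 5 and ?g1.0 = 125])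
      simp_all
  then show ?thesis
    by simp
qed

lemma solutions_14:
  "card (solutions 14 5 6875) = 5 \<and> snd ` solutions 14 5 6875 = {0, 2, 4, 5, 6}"
proof -
  let ?ns = "[0 :: nat, 2, 4, 5, 6]"
  have "filter (\<lambda>n. is_square_int (14 * 5 ^ n + 6875)) [0..<8] = ?ns"
    by code_simp
  then have "card (solutions 14 5 6875) = length ?ns \<and>
      snd ` solutions 14 5 6875 = set ?ns"
    using no_solution_14_11 no_solution_70_11
    by (intro solutions_eqI[where N = 11 and f = 25 and ?m0.0 = 4 and ?g0.0 = 25 and ?m1.0 = 3 and ?g1.0 = 5])
      simp_all
  then show ?thesis
    by simp
qed

lemma solutions_248:
  "card (solutions 248 6 23161) = 5 \<and> snd ` solutions 248 6 23161 = {0, 1, 3, 4, 5}"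
proof -
  let ?ns = "[0 :: nat, 1, 3, 4, 5]"
  have "filter (\<lambda>n. is_square_int (248 * 6 ^ n + 23161)) [0..<6] = ?ns"
    by code_simp
  then have "card (solutions 248 6 23161) = length ?ns \<and>
      snd ` solutions 248 6 23161 = set ?ns"
    using no_solution_248_23161 no_solution_1488_23161
    by (intro solutions_eqI[where N = 23161 and f = 1 and ?m0.0 = 3 and ?g0.0 = 216 and ?m1.0 = 3 and ?g1.0 = 216])
      simp_all
  then show ?thesis
    by simp
qed

text \<open>\<open>f = 108\<close> is not a power of 6, but it divides \<open>6 ^ 5\<close> and
  \<open>6 ^ 7\<close>.\<close>

lemma solutions_1513:
  "card (solutions 1513 6 19379701008) = 5 \<and> snd ` solutions 1513 6 19379701008 = {0, 7, 9, 10, 12}"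
proof -
  let ?ns = "[0 :: nat, 7, 9, 10, 12]"
  have "filter (\<lambda>n. is_square_int (1513 * 6 ^ n + 19379701008)) [0..<14] = ?ns"
    by code_simp
  then have "card (solutions 1513 6 19379701008) = length ?ns \<and>
      snd ` solutions 1513 6 19379701008 = set ?ns"
    using no_solution_1513_1661497 no_solution_9078_1661497
    by (intro solutions_eqI[where N = 1661497 and f = 108 and ?m0.0 = 7 and ?g0.0 = 2592 and ?m1.0 = 5 and ?g1.0 = 72])
      simp_all
  then show ?thesis
    by simp
qed

theorem theorem2p7:
  shows "(card (solutions 28 3 2997) = 5 \<and> snd ` solutions 28 3 2997 = {0, 2, 5, 6, 10}) \<and>
         (card (solutions 70 3 414) = 5 \<and> snd ` solutions 70 3 414 = {0, 3, 4, 5, 8}) \<and>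
         (card (solutions 130 3 5550606) = 5 \<and> snd ` solutions 130 3 5550606 = {0, 6, 11, 15, 16}) \<and>
         (card (solutions 148 3 41877) = 5 \<and> snd ` solutions 148 3 41877 = {0, 5, 6, 9, 17}) \<and>
         (card (solutions 8740 3 57402189) = 5 \<and> snd ` solutions 8740 3 57402189 = {0, 4, 9, 15, 29}) \<and>
         (card (solutions 6 5 11875) = 5 \<and> snd ` solutions 6 5 11875 = {0, 4, 5, 6, 9}) \<and>
         (card (solutions 14 5 6875) = 5 \<and> snd ` solutions 14 5 6875 = {0, 2, 4, 5, 6}) \<and>
         (card (solutions 248 6 23161) = 5 \<and> snd ` solutions 248 6 23161 = {0, 1, 3, 4, 5}) \<and>
         (card (solutions 1513 6 19379701008) = 5 \<and> snd ` solutions 1513 6 19379701008 = {0, 7, 9, 10, 12})"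
  using solutions_28 solutions_70 solutions_130 solutions_148 solutions_8740 solutions_6
    solutions_14 solutions_248 solutions_1513
  by blast

end
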